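(* Let $\mathbb C^2_*=\mathbb C^2\setminus\{0\}$ and let $\phi\in\mathrm{Aut}(\mathbb P^1)$ be $\phi(v)=\frac{v+1/2}{1+v/2}$. Let $\mathbb Z$ act on $\tilde B=\mathbb C^2_*\times\mathbb P^1$ by $n\cdot(z,v)=(2^nz,\phi^n(v))$, let $B=\tilde B/\mathbb Z$ with quotient map $\tilde\pi$ (a flat $\mathbb P^1$-bundle over the Hopf surface $H=\mathbb C^2_*/\{z\mapsto 2^nz\}$), and let $\Omega=\tilde\pi(\mathbb C^2_*\times\Delta)$, where $\Delta$ is the open unit disc. Then the closure $\overline\Omega=\Omega\cup\tilde\pi(\mathbb C^2_*\times S^1)$ of $\Omega$ in $B$ has no pseudoconvex neighborhood basis; more precisely, there is no decreasing sequence of pseudoconvex domains $\Omega_n$ in $B$ with $\bigcap_n\Omega_n=\overline\Omega$.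
   Context: $S^1$ is the unit circle in $\mathbb C$. A pseudoconvex neighborhood basis of a set $K$ is a family of pseudoconvex open neighborhoods of $K$ such that every open neighborhood of $K$ contains one of them. *)

theory Defs
  imports "HOL-Analysis.Analysis"
begin

text \<open>Points of the projective line: None is the point at infinity.\<close>
type_synonym p1 = "complex option"
type_synonym bt = "(complex \<times> complex) \<times> p1"
type_synonym c3 = "complex \<times> complex \<times> complex"

definition Btilde :: "bt set" where
  "Btilde = {(z, v). z \<noteq> (0, 0)}"

definition inv_chart :: "complex \<Rightarrow> p1" where
  "inv_chart w = (if w = 0 then None else Some (1 / w))"

definition chart0_set :: "bt set \<Rightarrow> c3 set" where
  "chart0_set D = {(a, b, c). (a, b) \<noteq> (0, 0) \<and> ((a, b), Some c) \<in> D}"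

definition chartinf_set :: "bt set \<Rightarrow> c3 set" where
  "chartinf_set D = {(a, b, c). (a, b) \<noteq> (0, 0) \<and> ((a, b), inv_chart c) \<in> D}"

definition Btilde_top :: "bt topology" where
  "Btilde_top = topology (\<lambda>D. D \<subseteq> Btilde \<and> open (chart0_set D) \<and> open (chartinf_set D))"

text \<open>phi(v) = (v + 1/2)/(1 + v/2) = (2v+1)/(v+2) on P^1, and its inverse (2w-1)/(2-w).\<close>
definition phi :: "p1 \<Rightarrow> p1" where
  "phi v = (case v of None \<Rightarrow> Some 2
     | Some a \<Rightarrow> (if a = -2 then None else Some ((a + 1/2) / (1 + a/2))))"

definition phi_inv :: "p1 \<Rightarrow> p1" where
  "phi_inv w = (case w of None \<Rightarrow> Some (-2)
     | Some a \<Rightarrow> (if a = 2 then None else Some ((2*a - 1) / (2 - a))))"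

definition phi_pow :: "int \<Rightarrow> p1 \<Rightarrow> p1" where
  "phi_pow n = (if n \<ge> 0 then phi ^^ nat n else phi_inv ^^ nat (- n))"

definition act :: "int \<Rightarrow> bt \<Rightarrow> bt" where
  "act n x = (case x of ((a, b), v) \<Rightarrow>
      (((2::complex) powi n * a, (2::complex) powi n * b), phi_pow n v))"

definition pi_B :: "bt \<Rightarrow> bt set" where
  "pi_B x = range (\<lambda>n. act n x)"

definition Bset :: "bt set set" where
  "Bset = pi_B ` Btilde"

definition B_top :: "bt set topology" where
  "B_top = topology (\<lambda>U. U \<subseteq> Bset \<and> openin Btilde_top (\<Union>U))"

definition Omega :: "bt set set" where
  "Omega = pi_B ` {(z, Some c) | z c. z \<noteq> (0, 0) \<and> norm c < 1}"

definition cscale :: "complex \<Rightarrow> c3 \<Rightarrow> c3" where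
  "cscale t x = (case x of (a, b, c) \<Rightarrow> (t * a, t * b, t * c))"

definition psh_on :: "c3 set \<Rightarrow> (c3 \<Rightarrow> real) \<Rightarrow> bool" where
  "psh_on U f \<longleftrightarrow> continuous_on U f \<and>
     (\<forall>p w. (\<forall>t. norm t \<le> 1 \<longrightarrow> p + cscale t w \<in> U) \<longrightarrow>
        f p \<le> (1 / (2 * pi)) * integral {0..2*pi} (\<lambda>s. f (p + cscale (cis s) w)))"

definition pseudoconvex_C3 :: "c3 set \<Rightarrow> bool" where
  "pseudoconvex_C3 U \<longleftrightarrow> open U \<and>
     (\<exists>f. psh_on U f \<and> (\<forall>c. compact {x \<in> U. f x \<le> c}))"

definition locally_pseudoconvex :: "bt set \<Rightarrow> bool" where
  "locally_pseudoconvex D \<longleftrightarrow>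
     (\<forall>a b c. (a, b) \<noteq> (0, 0) \<longrightarrow>
        (\<exists>r>0. pseudoconvex_C3 (chart0_set D \<inter> ball (a, b, c) r)) \<and>
        (\<exists>r>0. pseudoconvex_C3 (chartinf_set D \<inter> ball (a, b, c) r)))"

text \<open>Pseudoconvex open subsets of B: open, with pseudoconvex preimage in the covering.\<close>
definition pseudoconvex_open_B :: "bt set set \<Rightarrow> bool" where
  "pseudoconvex_open_B U \<longleftrightarrow> openin B_top U \<and> locally_pseudoconvex (\<Union>U)"

definition pseudoconvex_domain_B :: "bt set set \<Rightarrow> bool" where
  "pseudoconvex_domain_B U \<longleftrightarrow> pseudoconvex_open_B U \<and> connectedin B_top U \<and> U \<noteq> {}"

end

theory Submission
  imports Defs
begin

text \<open>
  Let \<open>D\<close> be the preimage in \<open>Btilde\<close> of a pseudoconvex neighbourhood of the closure of \<open>Omega\<close>.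
  Over the compact shell \<open>1 \<le> norm z \<le> 2\<close> the set \<open>D\<close> contains all points with \<open>v\<close> near the fixed
  point \<open>-1\<close>. For \<open>v \<noteq> 1\<close> the iterates of \<open>phi_inv\<close> move \<open>v\<close> to \<open>-1\<close>, so by invariance the slice of
  \<open>D\<close> at height \<open>v\<close> contains all \<open>z\<close> of large norm. If the slice were not everything, its complement
  would have a point of largest norm; there the slice contains the outside of a sphere, and
  discs tangent to this sphere contradict local pseudoconvexity. So \<open>D\<close> is all of \<open>Btilde\<close>,
  whereas the closure of \<open>Omega\<close> also lies in the proper open subset of \<open>B\<close> obtained by removing an
  invariant graph.
\<close>

section \<open>The action\<close>

lemma phi_phi_inv [simp]: "phi (phi_inv v) = v"
proof (cases v)
  case (Some a)
  show ?thesis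
  proof (cases "a = 2")
    case False
    then have "2 - a \<noteq> 0" by simp
    then have "(2*a - 1) / (2 - a) \<noteq> -2" by (simp add: divide_simps)
    moreover have "((2*a - 1) / (2 - a) + 1/2) / (1 + (2*a - 1) / (2 - a) / 2) = a"
      using \<open>2 - a \<noteq> 0\<close> by (simp add: divide_simps)
    ultimately show ?thesis using Some False by (simp add: phi_def phi_inv_def)
  qed (simp add: Some phi_def phi_inv_def)
qed (simp add: phi_def phi_inv_def)

lemma phi_fraction_eq: "(a + 1/2) / (1 + a/2) = (2*a + 1) / (2 + a)" for a :: complex
proof -
  have "a + 1/2 = (2*a + 1) * (1/2)" "1 + a/2 = (2 + a) * (1/2)" by (simp_all add: field_simps)
  then show ?thesis by (metis mult_divide_mult_cancel_right zero_neq_numeral divide_eq_0_iff zero_neq_one)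
qed

lemma phi_inv_phi [simp]: "phi_inv (phi v) = v"
proof (cases v)
  case (Some a)
  show ?thesis
  proof (cases "a = -2")
    case False
    then have nz: "2 + a \<noteq> 0" by (metis add_eq_0_iff)
    have "(2*a + 1) / (2 + a) \<noteq> 2" using nz by (simp add: divide_simps)
    moreover have "(2*((2*a + 1) / (2 + a)) - 1) / (2 - (2*a + 1) / (2 + a)) = a"
      using nz by (simp add: divide_simps)
    ultimately show ?thesis using Some False by (simp add: phi_def phi_inv_def phi_fraction_eq)
  qed (simp add: Some phi_def phi_inv_def)
qed (simp add: phi_def phi_inv_def)

lemma phi_pow_0 [simp]: "phi_pow 0 v = v"
  by (simp add: phi_pow_def)

lemma phi_pow_1 [simp]: "phi_pow 1 v = phi v"
  by (simp add: phi_pow_def)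

lemma phi_pow_minus_of_nat: "phi_pow (- int n) = phi_inv ^^ n"
  by (auto simp: phi_pow_def fun_eq_iff)

lemma phi_pow_of_nat: "phi_pow (int n) = phi ^^ n"
  by (simp add: phi_pow_def)

lemma phi_pow_plus_1: "phi_pow (n + 1) v = phi (phi_pow n v)"
proof (cases n rule: int_cases)
  case (nonneg k)
  then have "n + 1 = int (Suc k)" by simp
  then show ?thesis using nonneg by (simp only: phi_pow_of_nat) simp
next
  case (neg k)
  then have "n + 1 = - int k" by simp
  then show ?thesis using neg by (simp only: phi_pow_minus_of_nat) simp
qed

lemma phi_pow_minus_1: "phi_pow (n - 1) v = phi_inv (phi_pow n v)"
  using phi_pow_plus_1[of "n - 1" v] by simp

lemma phi_pow_add: "phi_pow (m + n) v = phi_pow m (phi_pow n v)"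
proof (induction m rule: int_induct[where k = 0])
  case (step1 i)
  then show ?case using phi_pow_plus_1[of "i + n" v] phi_pow_plus_1[of i "phi_pow n v"]
    by (simp add: algebra_simps)
next
  case (step2 i)
  then show ?case using phi_pow_minus_1[of "i + n" v] phi_pow_minus_1[of i "phi_pow n v"]
    by (simp add: algebra_simps)
qed simp

lemma act_0 [simp]: "act 0 x = x"
  by (cases x) (auto simp: act_def)

lemma act_add: "act (m + n) x = act m (act n x)"
  by (cases x) (auto simp: act_def phi_pow_add power_int_add)

lemma act_1: "act 1 ((a, b), v) = ((2 * a, 2 * b), phi v)"
  by (simp add: act_def)

lemma act_in_Btilde [simp]: "act n x \<in> Btilde \<longleftrightarrow> x \<in> Btilde"
  by (cases x) (auto simp: act_def Btilde_def)

lemma mem_pi_B_self: "x \<in> pi_B x"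
  unfolding pi_B_def by (metis act_0 rangeI)

lemma pi_B_eqI:
  assumes "y \<in> pi_B x" shows "pi_B y = pi_B x"
proof -
  obtain n where n: "y = act n x" using assms by (auto simp: pi_B_def)
  have "act m y = act (m + n) x" "act m x = act (m - n) y" for m
    by (simp_all add: n flip: act_add)
  then show ?thesis unfolding pi_B_def by (metis (no_types, lifting) image_subset_iff rangeI subset_antisym)
qed

text \<open>Orbits that meet coincide. This is what identifies subsets of B with invariant subsets
  of the covering.\<close>

lemma Union_Bset_iff:
  assumes "U \<subseteq> Bset" shows "x \<in> \<Union>U \<longleftrightarrow> pi_B x \<in> U"
proof
  assume "x \<in> \<Union>U"
  then obtain X where X: "X \<in> U" "x \<in> X" by blast
  then obtain y where "X = pi_B y" using assms unfolding Bset_def by blast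
  then show "pi_B x \<in> U" using X pi_B_eqI by metis
qed (use mem_pi_B_self in blast)

lemma act_Union_Bset_iff:
  assumes "U \<subseteq> Bset" shows "act n x \<in> \<Union>U \<longleftrightarrow> x \<in> \<Union>U"
proof -
  have "act n x \<in> pi_B x" by (simp add: pi_B_def)
  then show ?thesis using pi_B_eqI by (simp only: Union_Bset_iff[OF assms])
qed

lemma act_invariant:
  assumes "\<And>x. act 1 x \<in> S \<longleftrightarrow> x \<in> S"
  shows "act n x \<in> S \<longleftrightarrow> x \<in> S"
proof (induction n rule: int_induct[where k = 0])
  case (step1 i)
  then show ?case using assms[of "act i x"] by (simp add: add.commute flip: act_add)
next
  case (step2 i)
  then show ?case using assms[of "act (i - 1) x"] by (simp flip: act_add)
qed simp

text \<open>Invariance under the generator of the group makes \<open>S\<close> a union of whole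
  orbits, so passing to B and back adds no points.\<close>

lemma Union_pi_B_image:
  assumes "\<And>x. act 1 x \<in> S \<longleftrightarrow> x \<in> S"
  shows "\<Union>(pi_B ` S) = S"
  using act_invariant[of S, OF assms] mem_pi_B_self by (auto simp: pi_B_def)

section \<open>The topologies\<close>

lemma openin_Btilde_top:
  "openin Btilde_top D \<longleftrightarrow> D \<subseteq> Btilde \<and> open (chart0_set D) \<and> open (chartinf_set D)"
proof -
  have *: "chart0_set (A \<inter> B) = chart0_set A \<inter> chart0_set B"
    "chartinf_set (A \<inter> B) = chartinf_set A \<inter> chartinf_set B"
    "chart0_set (\<Union>K) = \<Union>(chart0_set ` K)"
    "chartinf_set (\<Union>K) = \<Union>(chartinf_set ` K)" for A B K
    by (auto simp: chart0_set_def chartinf_set_def)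
  have "istopology (\<lambda>D. D \<subseteq> Btilde \<and> open (chart0_set D) \<and> open (chartinf_set D))"
    unfolding istopology_def * by (auto intro!: open_Int)
  then show ?thesis unfolding Btilde_top_def by simp
qed

text \<open>The axiom at stake is closure under intersection: the union of a common subfamily can be
  smaller than the intersection of the two unions in general, but not for families of orbits, which
  are disjoint or equal.\<close>

lemma openin_B_top: "openin B_top U \<longleftrightarrow> U \<subseteq> Bset \<and> openin Btilde_top (\<Union>U)"
proof -
  have "\<Union>(S \<inter> T) = \<Union>S \<inter> \<Union>T" if "S \<subseteq> Bset" "T \<subseteq> Bset" for S T
  proof -
    have "S \<inter> T \<subseteq> Bset" using that by blast
    then have "x \<in> \<Union>(S \<inter> T) \<longleftrightarrow> x \<in> \<Union>S \<inter> \<Union>T" for x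
      by (simp only: Union_Bset_iff that Int_iff)
    then show ?thesis by blast
  qed
  moreover have "\<Union>(\<Union>K) = \<Union>(Union ` K)" for K :: "bt set set set" by blast
  ultimately have "istopology (\<lambda>U. U \<subseteq> Bset \<and> openin Btilde_top (\<Union>U))"
    unfolding istopology_def by (auto intro!: openin_Int) 
  then show ?thesis unfolding B_top_def by simp
qed

lemma openin_pi_B_image:
  assumes "\<And>x. act 1 x \<in> S \<longleftrightarrow> x \<in> S" "openin Btilde_top S"
  shows "openin B_top (pi_B ` S)"
  using assms by (auto simp: openin_B_top openin_Btilde_top Union_pi_B_image Bset_def)

lemma Btilde_charts: "chart0_set Btilde = {(a, b, c). (a, b) \<noteq> (0, 0)}"
  "chartinf_set Btilde = {(a, b, c). (a, b) \<noteq> (0, 0)}"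
  by (auto simp: chart0_set_def chartinf_set_def Btilde_def)

lemma open_nonzero: "open ({(a, b, c). (a, b) \<noteq> (0, 0)} :: c3 set)"
proof -
  have "({(a, b, c). (a, b) \<noteq> (0, 0)} :: c3 set) = {x. fst x \<noteq> 0} \<union> {x. fst (snd x) \<noteq> 0}"
    by auto
  then show ?thesis by (auto intro!: open_Un open_Collect_neq continuous_intros)
qed

text \<open>A point c of the closed disc is the limit of r c as r increases to 1, and these points
  lie in the open disc.\<close>

lemma mem_closure_Omega:
  assumes "z \<noteq> (0, 0)" "norm c \<le> 1"
  shows "pi_B (z, Some c) \<in> B_top closure_of Omega"
proof -
  obtain a b where z: "z = (a, b)" by (cases z)
  have Bset: "pi_B (z, Some c) \<in> Bset" using assms by (auto simp: Bset_def Btilde_def)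
  have "openin B_top Bset"
    unfolding Bset_def using open_nonzero
    by (intro openin_pi_B_image) (simp_all add: openin_Btilde_top Btilde_charts)
  then have top: "pi_B (z, Some c) \<in> topspace B_top" using Bset by (meson openin_subset subsetD)
  have "\<exists>y\<in>Omega. y \<in> T" if T: "pi_B (z, Some c) \<in> T" "openin B_top T" for T
  proof -
    have TB: "T \<subseteq> Bset" and op: "open (chart0_set (\<Union>T))"
      using T by (auto simp: openin_B_top openin_Btilde_top)
    have "(a, b, c) \<in> chart0_set (\<Union>T)"
      using T assms Union_Bset_iff[OF TB] by (simp add: chart0_set_def z)
    moreover have "((\<lambda>r. (a, b, of_real r * c)) \<longlongrightarrow> (a, b, of_real 1 * c)) (at_left 1)"
      by (intro tendsto_intros)
    ultimately have "\<forall>\<^sub>F r in at_left 1. (a, b, of_real r * c) \<in> chart0_set (\<Union>T)"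
      using op by (intro topological_tendstoD) auto
    moreover have "\<forall>\<^sub>F r in at_left (1::real). r \<in> {0<..<1}"
      by (rule eventually_at_leftI[of 0]) auto
    ultimately have "\<forall>\<^sub>F r in at_left 1. r \<in> {0<..<1} \<and> (a, b, of_real r * c) \<in> chart0_set (\<Union>T)"
      by (rule eventually_conj[rotated])
    from eventually_happens[OF this]
    obtain r :: real where r: "0 < r" "r < 1" "(a, b, of_real r * c) \<in> chart0_set (\<Union>T)"
      by auto
    have "norm (of_real r * c) < 1"
    proof -
      have "r * norm c \<le> r" using r assms(2) by (intro mult_left_le) auto
      then have "r * norm c < 1" using r by linarith
      then show ?thesis using r by (simp add: norm_mult)
    qed
    then have "pi_B (z, Some (of_real r * c)) \<in> Omega" using assms unfolding Omega_def by blast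
    moreover have "pi_B (z, Some (of_real r * c)) \<in> T"
      using r(3) Union_Bset_iff[OF TB] by (simp add: chart0_set_def z)
    ultimately show ?thesis by blast
  qed
  then show ?thesis using top by (auto simp: in_closure_of)
qed

section \<open>Slices of invariant pseudoconvex sets\<close>

text \<open>The discs through \<open>((1 + s) a, (1 + s) b, c)\<close> in the complex tangent direction of the sphere
  stay in \<open>S\<close> for \<open>s > 0\<close>, and their boundaries stay in a compact subset of \<open>S\<close> as \<open>s\<close> tends to \<open>0\<close>.\<close>
lemma pseudoconvex_farthest_point:
  assumes psc: "pseudoconvex_C3 (S \<inter> ball (a, b, c) r)" and r: "r > 0" and ab: "(a, b) \<noteq> (0, 0)"
    and out: "\<And>a' b'. norm (a', b') > norm (a, b) \<Longrightarrow> (a', b', c) \<in> S"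
  shows "(a, b, c) \<in> S"
proof -
  define U where "U = S \<inter> ball (a, b, c) r"
  obtain f where psh: "psh_on U f" and cpt: "\<And>m. compact {x \<in> U. f x \<le> m}"
    using psc unfolding pseudoconvex_C3_def U_def by blast
  have cont: "continuous_on U f" using psh by (simp add: psh_on_def)
  define N where "N = norm (a, b)"
  have N: "N > 0" using ab by (simp add: N_def zero_prod_def)
  have N2: "N\<^sup>2 = (norm a)\<^sup>2 + (norm b)\<^sup>2" by (simp add: N_def norm_Pair)
  \<comment> \<open>A radial shift by at most \<open>e * N\<close> plus a move along the disc by at
    most \<open>e * N\<close> totals at most 2r/3, so everything stays in the ball.\<close>
  define e where "e = r / (3 * N)"
  have e: "e > 0" "e * N < r / 2" using r N by (auto simp: e_def)
  define q where "q s = (of_real (1 + s) * a, of_real (1 + s) * b, c)" for s :: real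
  \<comment> \<open>The direction is Hermitian orthogonal to \<open>(a, b)\<close>, hence complex
    tangent to the sphere, and has norm \<open>e * N\<close>.\<close>
  define w where "w = (- of_real e * cnj b, of_real e * cnj a, 0 :: complex)"
  \<comment> \<open>Only the centre of the limiting disc, s = 0 and t = 0, is excluded: that is the
    point whose membership is to be shown.\<close>
  have inU: "q s + cscale t w \<in> U" if "0 \<le> s" "s \<le> e" "norm t \<le> 1" "s > 0 \<or> t \<noteq> 0" for s t
  proof -
    define a' b' where "a' = of_real (1 + s) * a - t * of_real e * cnj b"
      and "b' = of_real (1 + s) * b + t * of_real e * cnj a"
    have eq: "q s + cscale t w = (a', b', c)"
      by (simp add: q_def w_def cscale_def a'_def b'_def)
    \<comment> \<open>Pythagoras: the cross terms cancel by orthogonality.\<close>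
    have "(norm a')\<^sup>2 + (norm b')\<^sup>2 = ((1 + s)\<^sup>2 + (norm t * e)\<^sup>2) * N\<^sup>2"
      unfolding N2 power_mult_distrib cmod_power2 a'_def b'_def
      by (simp add: power2_eq_square algebra_simps)
    moreover have "(1 + s)\<^sup>2 + (norm t * e)\<^sup>2 > 1"
    proof (cases "s > 0")
      case True
      then have "(1 + s)\<^sup>2 > 1" by (simp add: power2_eq_square algebra_simps add_pos_nonneg)
      moreover have "(norm t * e)\<^sup>2 \<ge> 0" by simp
      ultimately show ?thesis by linarith
    next
      case False
      then have "(norm t * e)\<^sup>2 > 0" using that e by simp
      moreover have "(1 + s)\<^sup>2 \<ge> 1" using that by simp
      ultimately show ?thesis by linarith
    qed
    ultimately have "(norm a')\<^sup>2 + (norm b')\<^sup>2 > N\<^sup>2" using N by simp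
    then have "norm (a', b') > norm (a, b)"
      by (simp add: norm_Pair N2)
    then have "(a', b', c) \<in> S" by (rule out)
    moreover have "dist (a, b, c) (a', b', c) < r"
    proof -
      have "(a', b', c) - (a, b, c) = s *\<^sub>R (a, b, 0) + (- (t * of_real e * cnj b), t * of_real e * cnj a, 0)"
        by (simp add: a'_def b'_def algebra_simps scaleR_conv_of_real)
      moreover have "norm (s *\<^sub>R (a, b, 0 :: complex)) = s * N"
        using that by (simp add: norm_Pair N_def del: scaleR_Pair)
      moreover have "norm (- (t * of_real e * cnj b), t * of_real e * cnj a, 0 :: complex) = norm t * e * N"
      proof -
        have "norm (- (t * of_real e * cnj b), t * of_real e * cnj a, 0 :: complex)
            = sqrt ((norm t * e)\<^sup>2 * N\<^sup>2)"
          unfolding N2 using e by (simp add: norm_Pair norm_mult power_mult_distrib algebra_simps)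
        also have "\<dots> = norm t * e * N" using e N by (simp add: real_sqrt_mult)
        finally show ?thesis .
      qed
      ultimately have "norm ((a', b', c) - (a, b, c)) \<le> s * N + norm t * e * N"
        by (metis norm_triangle_ineq)
      also have "\<dots> \<le> e * N + 1 * e * N"
        using that e N by (intro add_mono mult_right_mono) auto
      also have "\<dots> < r" using e(2) by linarith
      finally show ?thesis by (metis dist_norm dist_commute)
    qed
    ultimately show ?thesis by (simp add: eq U_def)
  qed
  define h where "h = (\<lambda>(s, \<theta>). q s + cscale (cis \<theta>) w)"
  have hcont: "continuous_on A h" for A
    unfolding h_def q_def w_def cscale_def by (auto simp: case_prod_unfold intro!: continuous_intros)
  \<comment> \<open>The circles with s = 0 are included. They avoid the centre and so lie in
    \<open>U\<close>, which makes the bound on \<open>f\<close> over the boundary circles uniform in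
    s.\<close>
  define K where "K = h ` ({0..e} \<times> {0..2*pi})"
  have "K \<subseteq> U" unfolding K_def h_def using inU by (auto simp: cis_neq_zero)
  moreover have "compact K" unfolding K_def by (intro compact_continuous_image hcont compact_Times compact_Icc)
  ultimately have "compact (f ` K)" by (meson compact_continuous_image cont continuous_on_subset)
  then obtain M where M: "\<And>x. x \<in> K \<Longrightarrow> f x \<le> M"
    by (meson bounded_imp_bdd_above bdd_above.unfold compact_imp_bounded imageI)
  \<comment> \<open>For s > 0 the whole closed disc lies in \<open>U\<close>, so the sub-mean value
    inequality carries the bound \<open>M\<close> from the circle to the centre.\<close>
  have sub: "q s \<in> {x \<in> U. f x \<le> M}" if s: "0 < s" "s \<le> e" for s
  proof -
    have "q s \<in> U" using inU[of s 0] s by (simp add: cscale_def w_def zero_prod_def[symmetric])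
    have c1: "continuous_on {0..2*pi} (\<lambda>\<theta>. f (q s + cscale (cis \<theta>) w))"
    proof (rule continuous_on_compose2[OF cont])
      have "continuous_on {0..2*pi} (h \<circ> Pair s)"
        by (intro continuous_on_compose hcont continuous_intros)
      then show "continuous_on {0..2*pi} (\<lambda>\<theta>. q s + cscale (cis \<theta>) w)"
        by (simp add: h_def o_def)
    qed (use inU s in auto)
    have "f (q s) \<le> (1 / (2 * pi)) * integral {0..2*pi} (\<lambda>\<theta>. f (q s + cscale (cis \<theta>) w))"
    proof -
      have "\<forall>t. norm t \<le> 1 \<longrightarrow> q s + cscale t w \<in> U" using inU s by simp
      then show ?thesis using psh[unfolded psh_on_def] by blast
    qed
    also have "integral {0..2*pi} (\<lambda>\<theta>. f (q s + cscale (cis \<theta>) w)) \<le> integral {0..2*pi} (\<lambda>\<theta>. M)"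
    proof (rule integral_le)
      show "f (q s + cscale (cis \<theta>) w) \<le> M" if "\<theta> \<in> {0..2*pi}" for \<theta>
        using s that by (intro M) (force simp: K_def h_def)
    qed (auto intro: integrable_continuous_interval c1)
    also have "1 / (2 * pi) * integral {0..2*pi} (\<lambda>\<theta>. M) = M" by simp
    finally show ?thesis using \<open>q s \<in> U\<close> by (simp add: divide_right_mono)
  qed
  \<comment> \<open>Exhaustion enters here: the sublevel set is closed in the whole space, so the
    limit \<open>q 0\<close> of the centres cannot escape to the boundary of
    \<open>U\<close>.\<close>
  have "closed {x \<in> U. f x \<le> M}" using cpt compact_imp_closed by blast
  moreover have "(q \<longlongrightarrow> q 0) (at_right 0)"
    unfolding q_def by (intro tendsto_intros)
  moreover have "\<forall>\<^sub>F s in at_right 0. q s \<in> {x \<in> U. f x \<le> M}"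
    by (rule eventually_at_rightI[of 0 e]) (use sub e in auto)
  ultimately have "q 0 \<in> {x \<in> U. f x \<le> M}"
    by (intro Lim_in_closed_set[of _ q "at_right 0"]) auto
  then show ?thesis by (simp add: q_def U_def)
qed

section \<open>Attraction of the iterates of \<open>phi_inv\<close> to the fixed point -1\<close>

text \<open>In the coordinate \<open>u = (1 + v) / (1 - v)\<close> the map \<open>phi\<close> is multiplication by \<open>3\<close>.\<close>
definition of_mult_coord :: "complex \<Rightarrow> p1" where
  "of_mult_coord u = (if u = -1 then None else Some ((u - 1) / (u + 1)))"

lemma phi_inv_of_mult_coord: "phi_inv (of_mult_coord u) = of_mult_coord (u / 3)"
proof -
  \<comment> \<open>The special values are those meeting infinity: u = -1 represents infinity
    itself, and u = -3 represents 2, which \<open>phi_inv\<close> sends to infinity.\<close>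
  consider "u = -1" | "u = -3" | "u \<noteq> -1" "u \<noteq> -3" by blast
  then show ?thesis
  proof cases
    case 3
    then have nz: "u + 1 \<noteq> 0" "u + 3 \<noteq> 0" by (auto simp: eq_neg_iff_add_eq_0)
    have "u / 3 \<noteq> -1" using 3 by (auto simp: field_simps)
    moreover have "(u - 1) / (u + 1) \<noteq> 2" using nz by (simp add: divide_simps) (use nz in algebra)
    moreover have "(2 * ((u - 1) / (u + 1)) - 1) / (2 - (u - 1) / (u + 1)) = (u / 3 - 1) / (u / 3 + 1)"
    proof -
      have "2 * ((u - 1) / (u + 1)) - 1 = (u - 3) / (u + 1)"
        "2 - (u - 1) / (u + 1) = (u + 3) / (u + 1)"
        using nz by (simp_all add: divide_simps)
      moreover have "(u / 3 - 1) / (u / 3 + 1) = (u - 3) / (u + 3)"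
        using mult_divide_mult_cancel_right[of "1/3" "u - 3" "u + 3"]
        by (simp add: diff_divide_distrib add_divide_distrib)
      ultimately show ?thesis using nz by simp
    qed
    ultimately show ?thesis using 3 by (simp only: of_mult_coord_def phi_inv_def) simp
  qed (auto simp: of_mult_coord_def phi_inv_def)
qed

lemma phi_inv_funpow_of_mult_coord: "(phi_inv ^^ n) (of_mult_coord u) = of_mult_coord (u / 3 ^ n)"
  by (induction n) (simp_all add: phi_inv_of_mult_coord field_simps)

text \<open>The fixed points -1 and 1 have coordinates 0 and infinity. For c other than 1 the
  coordinate u is finite, and u / 3^n tends to 0.\<close>

lemma phi_inv_funpow_tendsto:
  assumes "c \<noteq> 1" "\<epsilon> > 0"
  shows "\<exists>N. \<forall>n\<ge>N. \<exists>d. (phi_inv ^^ n) (Some c) = Some d \<and> dist d (-1) < \<epsilon>"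
proof -
  define u where "u = (1 + c) / (1 - c)"
  have "1 - c \<noteq> 0" using assms by simp
  then have "u \<noteq> -1" "(u - 1) / (u + 1) = c"
    by (auto simp: u_def divide_simps)
  then have Sc: "Some c = of_mult_coord u" by (simp add: of_mult_coord_def)
  have "(\<lambda>n. u * (1/3) ^ n) \<longlonglongrightarrow> u * 0"
    by (intro tendsto_intros LIMSEQ_power_zero) simp
  then have lim: "(\<lambda>n. u / 3 ^ n) \<longlonglongrightarrow> 0" by (simp add: power_one_over)
  have "(\<lambda>n. (u / 3 ^ n - 1) / (u / 3 ^ n + 1)) \<longlonglongrightarrow> (0 - 1) / (0 + 1)"
    by (intro tendsto_intros lim) simp
  then have "\<forall>\<^sub>F n in sequentially. dist ((u / 3 ^ n - 1) / (u / 3 ^ n + 1)) (-1) < \<epsilon>"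
    using assms(2) by (auto dest: tendstoD)
  \<comment> \<open>This keeps the iterates away from infinity, so that they are eventually of the
    form \<open>Some d\<close>.\<close>
  moreover have "\<forall>\<^sub>F n in sequentially. u / 3 ^ n \<noteq> -1"
    using lim by (rule tendsto_imp_eventually_ne) simp
  ultimately have "\<forall>\<^sub>F n in sequentially. \<exists>d. (phi_inv ^^ n) (Some c) = Some d \<and> dist d (-1) < \<epsilon>"
    unfolding Sc phi_inv_funpow_of_mult_coord by eventually_elim (simp add: of_mult_coord_def)
  then show ?thesis by (simp add: eventually_sequentially)
qed

section \<open>Fullness of the slices\<close>

lemma Union_pseudoconvex_eq_Btilde:
  assumes psc: "pseudoconvex_open_B U" and cl: "B_top closure_of Omega \<subseteq> U"
  shows "\<Union>U = Btilde"
proof -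
  define D where "D = \<Union>U"
  have UB: "U \<subseteq> Bset" and DB: "D \<subseteq> Btilde" and opD: "open (chart0_set D)"
    and lpc: "locally_pseudoconvex D"
    using psc by (auto simp: pseudoconvex_open_B_def openin_B_top openin_Btilde_top D_def)
  note D_act = act_Union_Bset_iff[OF UB, folded D_def]
  have D_disc: "(z, Some c) \<in> D" if "z \<noteq> (0, 0)" "norm c \<le> 1" for z c
    using mem_closure_Omega[OF that] cl Union_Bset_iff[OF UB] by (auto simp: D_def)
  \<comment> \<open>A compact set meeting every orbit of z -> 2z on the punctured space.\<close>
  define Shell where "Shell = {z :: complex \<times> complex. 1 \<le> norm z \<and> norm z \<le> 2}"
  have "Shell = cball 0 2 - ball 0 1" by (auto simp: Shell_def)
  then have "compact Shell" by (simp add: compact_diff)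
  have "\<exists>\<epsilon>>0. \<forall>z\<in>Shell. \<forall>d. dist d (-1) < \<epsilon> \<longrightarrow> (z, Some d) \<in> D"
  proof -
    \<comment> \<open>Tube argument: -1 lies on the unit circle, so \<open>D\<close> contains the
      compact set Shell x {-1}, and compactness gives one radius for all z.\<close>
    define C where "C = (\<lambda>z. (fst z, snd z, -1 :: complex)) ` Shell"
    have "compact C" unfolding C_def
      by (intro compact_continuous_image continuous_intros \<open>compact Shell\<close>)
    moreover have "C \<subseteq> chart0_set D"
    proof
      fix x assume "x \<in> C"
      then obtain a b where x: "x = (a, b, -1)" "(a, b) \<in> Shell" by (auto simp: C_def)
      then have "(a, b) \<noteq> (0, 0)" by (auto simp: Shell_def zero_prod_def[symmetric])
      with x show "x \<in> chart0_set D" using D_disc[of "(a, b)" "-1"] by (simp add: chart0_set_def)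
    qed
    ultimately obtain \<epsilon> where \<epsilon>: "\<epsilon> > 0" "(\<Union>x\<in>C. ball x \<epsilon>) \<subseteq> chart0_set D"
      using compact_subset_open_imp_ball_epsilon_subset opD by metis
    have "(z, Some d) \<in> D" if "z \<in> Shell" "dist d (-1) < \<epsilon>" for z d
    proof -
      have "(fst z, snd z, -1) \<in> C" using that by (auto simp: C_def)
      moreover have "(fst z, snd z, d) \<in> ball (fst z, snd z, -1) \<epsilon>"
        using that by (simp add: dist_Pair_Pair dist_commute)
      ultimately have "(fst z, snd z, d) \<in> chart0_set D" using \<epsilon> by blast
      then show ?thesis by (simp add: chart0_set_def)
    qed
    then show ?thesis using \<epsilon>(1) by blast
  qed
  then obtain \<epsilon> where \<epsilon>: "\<epsilon> > 0" "\<And>z d. z \<in> Shell \<Longrightarrow> dist d (-1) < \<epsilon> \<Longrightarrow> (z, Some d) \<in> D"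
    by blast
  \<comment> \<open>The value c = 1 does not move under \<open>phi_inv\<close>, but it lies on the
    unit circle and is covered by \<open>D_disc\<close>.\<close>
  have finite_slice: "((a0, b0), Some c) \<in> D" if ab0: "(a0, b0) \<noteq> (0, 0)" for a0 b0 c
  proof (cases "c = 1")
    case True
    then show ?thesis using D_disc ab0 by simp
  next
    case False
    obtain N where N: "\<And>n. n \<ge> N \<Longrightarrow> \<exists>d. (phi_inv ^^ n) (Some c) = Some d \<and> dist d (-1) < \<epsilon>"
      using phi_inv_funpow_tendsto[OF False \<epsilon>(1)] by blast
    have far: "((a, b), Some c) \<in> D" if ge: "norm (a, b) \<ge> 2 ^ N" for a b
    proof -
      \<comment> \<open>Scaling by 2^(-n) brings the point into \<open>Shell\<close>, and a norm of
        at least 2^N forces n >= N, so the same n also brings c close to -1.\<close>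
      obtain n where n: "n \<ge> N" "2 ^ n \<le> norm (a, b)" "norm (a, b) < 2 ^ Suc n"
      proof -
        define m where "m = (LEAST m. norm (a, b) < 2 ^ m)"
        have m: "norm (a, b) < 2 ^ m"
          unfolding m_def by (rule LeastI_ex) (simp add: real_arch_pow)
        then have "(2::real) ^ N < 2 ^ m" using ge by linarith
        then have "N < m" by simp
        then have "\<not> norm (a, b) < 2 ^ (m - 1)"
          unfolding m_def by (intro not_less_Least) simp
        with m \<open>N < m\<close> show ?thesis by (intro that[of "m - 1"]) auto
      qed
      have "act (- int n) ((a, b), Some c) = ((1 / 2 ^ n) *\<^sub>R (a, b), (phi_inv ^^ n) (Some c))"
        by (simp add: act_def phi_pow_minus_of_nat power_int_minus scaleR_conv_of_real divide_simps)
      moreover have "(1 / 2 ^ n) *\<^sub>R (a, b) \<in> Shell"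
        using n by (simp add: Shell_def divide_simps del: scaleR_Pair)
      ultimately have "act (- int n) ((a, b), Some c) \<in> D"
        using N[OF n(1)] \<epsilon>(2) by auto
      then show ?thesis by (simp add: D_act)
    qed
    show ?thesis
    proof (rule ccontr)
      assume contra: "((a0, b0), Some c) \<notin> D"
      \<comment> \<open>The lower bound on the norm keeps \<open>K\<close> away from the origin,
        where the slice is undefined; this makes \<open>K\<close> closed in the whole plane and
        hence compact.\<close>
      define K where "K = {z. norm z \<ge> norm (a0, b0) \<and> (z, Some c) \<notin> D}"
      have nz: "(a, b) \<noteq> (0, 0)" if "norm (a, b) \<ge> norm (a0, b0)" for a b
        using that ab0 by (auto simp: zero_prod_def[symmetric])
      have "norm z \<le> 2 ^ N" if "z \<in> K" for z
        using far[of "fst z" "snd z"] that by (cases "2 ^ N \<le> norm z") (auto simp: K_def)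
      then have "K \<subseteq> cball 0 (2 ^ N)" by auto
      then have "bounded K" using bounded_cball bounded_subset by blast
      moreover have "closed K"
      proof -
        have "K = {z. norm z \<ge> norm (a0, b0)} \<inter> (\<lambda>z. (fst z, snd z, c)) -` (- chart0_set D)"
        proof (rule set_eqI)
          fix z show "z \<in> K \<longleftrightarrow> z \<in> {z. norm z \<ge> norm (a0, b0)} \<inter> (\<lambda>z. (fst z, snd z, c)) -` (- chart0_set D)"
            using nz[of "fst z" "snd z"] by (cases z) (auto simp: K_def chart0_set_def)
        qed
        moreover have "closed ((\<lambda>z :: complex \<times> complex. (fst z, snd z, c)) -` (- chart0_set D))"
          using opD by (intro continuous_closed_vimage) (auto intro!: continuous_intros)
        ultimately show ?thesis by (auto intro!: closed_Int closed_Collect_le continuous_intros)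
      qed
      ultimately have "compact K" by (simp add: compact_eq_bounded_closed)
      moreover have "K \<noteq> {}" using contra by (auto simp: K_def)
      ultimately obtain z where z: "z \<in> K" "\<And>y. y \<in> K \<Longrightarrow> norm y \<le> norm z"
        using continuous_attains_sup[of K norm] continuous_on_norm_id by blast
      obtain a b where ab: "z = (a, b)" by (cases z)
      have abnz: "(a, b) \<noteq> (0, 0)" using z ab nz by (auto simp: K_def)
      obtain r where r: "r > 0" "pseudoconvex_C3 (chart0_set D \<inter> ball (a, b, c) r)"
        using lpc abnz unfolding locally_pseudoconvex_def by blast
      have "(a, b, c) \<in> chart0_set D"
      proof (rule pseudoconvex_farthest_point[OF r(2,1) abnz])
        fix a' b' :: complex assume *: "norm (a', b') > norm (a, b)"
        moreover have "norm (a, b) \<ge> norm (a0, b0)" using z ab by (simp add: K_def)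
        ultimately have "norm (a', b') \<ge> norm (a0, b0)" by linarith
        then show "(a', b', c) \<in> chart0_set D"
          using * z(2)[of "(a', b')"] nz[of a' b'] ab by (auto simp: K_def chart0_set_def)
      qed
      then show False using z ab by (simp add: K_def chart0_set_def)
    qed
  qed
  have "x \<in> D" if "x \<in> Btilde" for x
  proof -
    obtain a b v where x: "x = ((a, b), v)" by (metis surj_pair)
    with that have nz: "(a, b) \<noteq> (0, 0)" by (simp add: Btilde_def)
    show ?thesis
    proof (cases v)
      case None
      \<comment> \<open>Infinity is moved to the finite point 2 by \<open>phi\<close>, and
        \<open>D\<close> is invariant.\<close>
      have "act 1 x \<in> D" using finite_slice[of "2 * a" "2 * b" 2] nz by (simp add: x None act_1 phi_def)
      then show ?thesis by (simp add: D_act)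
    qed (use finite_slice[OF nz] x in simp)
  qed
  then show ?thesis using DB by (auto simp: D_def)
qed

section \<open>A small neighbourhood of the closure\<close>

text \<open>Its image in B is an open set disjoint from \<open>Omega\<close>, hence also from the
  closure of \<open>Omega\<close>.\<close>

definition outer_set :: "bt set" where
  "outer_set = {(z, v). z \<noteq> (0, 0) \<and> (case v of None \<Rightarrow> True | Some c \<Rightarrow> norm c > 1)}"

text \<open>The exponent makes doubling z multiply the value by 3, the factor by which
  \<open>phi\<close> acts on the coordinate u.\<close>

definition height :: "complex \<times> complex \<Rightarrow> complex" where
  "height z = of_real (norm z powr log 2 3)"

text \<open>The complement of the graph \<open>(1 + v) / (1 - v) = - height z\<close>, which is invariant because
  both sides are multiplied by \<open>3\<close>.\<close>
definition graph_complement :: "bt set" where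
  "graph_complement = {(z, v). z \<noteq> (0, 0) \<and>
     (case v of None \<Rightarrow> height z \<noteq> 1 | Some c \<Rightarrow> 1 + c \<noteq> - height z * (1 - c))}"

lemma height_double: "height (2 * a, 2 * b) = 3 * height (a, b)"
proof -
  have "norm (2 * a, 2 * b) = norm (2 *\<^sub>R (a, b))" by (simp add: scaleR_conv_of_real)
  also have "\<dots> = 2 * norm (a, b)" by (simp del: scaleR_Pair)
  finally show ?thesis by (simp add: height_def powr_mult)
qed

text \<open>The identity |a + 1/2|^2 - |1 + a/2|^2 = (3/4)(|a|^2 - 1) decides the
  comparison.\<close>

lemma norm_phi_gt_1_iff:
  fixes a :: complex
  assumes "a \<noteq> -2"
  shows "norm ((a + 1/2) / (1 + a/2)) > 1 \<longleftrightarrow> norm a > 1"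
proof -
  have "2 * (1 + a/2) = a + 2" by (simp add: algebra_simps)
  then have nz: "1 + a/2 \<noteq> 0" using assms by (metis eq_neg_iff_add_eq_0 mult_zero_right)
  have "norm ((a + 1/2) / (1 + a/2)) > 1 \<longleftrightarrow> (norm (a + 1/2))\<^sup>2 > (norm (1 + a/2))\<^sup>2"
  proof -
    have "X / Y > 1 \<longleftrightarrow> X\<^sup>2 > Y\<^sup>2" if "X \<ge> 0" "Y > 0" for X Y :: real
      using that power2_less_imp_less[of Y X] power_strict_mono[of Y X 2] by auto
    then show ?thesis using nz unfolding norm_divide by (metis norm_ge_zero zero_less_norm_iff)
  qed
  also have "\<dots> \<longleftrightarrow> (norm a)\<^sup>2 > 1\<^sup>2"
    unfolding cmod_power2 by (simp add: power2_eq_square algebra_simps) linarith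
  also have "\<dots> \<longleftrightarrow> norm a > 1" using power2_less_imp_less[of 1 "norm a"] by auto
  finally show ?thesis .
qed

lemma act_1_outer_set: "act 1 x \<in> outer_set \<longleftrightarrow> x \<in> outer_set"
proof -
  obtain a b v where "x = ((a, b), v)" by (metis surj_pair)
  then show ?thesis using norm_phi_gt_1_iff
    by (cases v) (auto simp: act_1 outer_set_def phi_def)
qed

lemma act_1_graph_complement: "act 1 x \<in> graph_complement \<longleftrightarrow> x \<in> graph_complement"
proof -
  obtain a b v where x: "x = ((a, b), v)" by (metis surj_pair)
  define k where "k = height (a, b)"
  show ?thesis
  proof (cases v)
    case None
    have "(3::complex) = 3 * k \<longleftrightarrow> k = 1" by auto
    then show ?thesis using None x by (auto simp: act_1 graph_complement_def phi_def height_double k_def)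
  next
    case (Some c)
    show ?thesis
    proof (cases "c = -2")
      case True
      \<comment> \<open>Here v = -2 has u = -1/3 and its image, infinity, has u = -1, so both
        conditions compare the height with 1/3.\<close>
      have "(- 1 = - k * 3) \<longleftrightarrow> 3 * k = 1" by (auto simp: algebra_simps)
      then show ?thesis using Some x True
        by (auto simp: act_1 graph_complement_def phi_def height_double k_def)
    next
      case False
      then have nz: "2 + c \<noteq> 0" by (auto simp: eq_neg_iff_add_eq_0 add.commute)
      \<comment> \<open>Passing to the image multiplies both sides of the graph equation by the same
        nonzero factor 3 / (2 + c).\<close>
      have "1 + (2 * c + 1) / (2 + c) = 3 * (1 + c) / (2 + c)"
        "- (3 * k) * (1 - (2 * c + 1) / (2 + c)) = 3 * (- k * (1 - c)) / (2 + c)"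
        using nz by (simp_all add: divide_simps)
      then have "1 + (2 * c + 1) / (2 + c) = - (3 * k) * (1 - (2 * c + 1) / (2 + c)) \<longleftrightarrow> 1 + c = - k * (1 - c)"
        using nz by (simp only: divide_cancel_right mult_cancel_left) simp
      then show ?thesis using Some x False
        by (auto simp: act_1 graph_complement_def phi_def height_double phi_fraction_eq simp flip: k_def)
    qed
  qed
qed

lemma openin_outer: "openin B_top (pi_B ` outer_set)"
proof -
  have "chart0_set outer_set = {(a, b, c). (a, b) \<noteq> (0, 0)} \<inter> {x. norm (snd (snd x)) > 1}"
    by (auto simp: chart0_set_def outer_set_def)
  moreover have "chartinf_set outer_set = {(a, b, c). (a, b) \<noteq> (0, 0)} \<inter> {x. norm (snd (snd x)) < 1}"
    by (auto simp: chartinf_set_def outer_set_def inv_chart_def norm_divide divide_simps split: if_splits)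
  ultimately have "open (chart0_set outer_set)" "open (chartinf_set outer_set)"
    by (simp_all only:) (intro open_Int open_nonzero open_Collect_less continuous_intros)+
  then have "openin Btilde_top outer_set"
    unfolding openin_Btilde_top by (auto simp: outer_set_def Btilde_def)
  then show ?thesis by (rule openin_pi_B_image[OF act_1_outer_set])
qed

lemma openin_graph_complement: "openin B_top (pi_B ` graph_complement)"
proof -
  let ?Z = "{(a, b, c). (a, b) \<noteq> (0, 0)} :: c3 set"
  have hc: "continuous_on ?Z (\<lambda>x. height (fst x, fst (snd x)))"
    unfolding height_def
  proof (intro continuous_on_of_real continuous_on_powr continuous_intros ballI)
    show "norm (fst x, fst (snd x)) \<noteq> 0" if "x \<in> ?Z" for x
      using that by (auto simp: zero_prod_def)
  qed
  have "chart0_set graph_complement =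
      ?Z \<inter> (\<lambda>x. 1 + snd (snd x) + height (fst x, fst (snd x)) * (1 - snd (snd x))) -` (- {0})"
    by (auto simp: chart0_set_def graph_complement_def eq_neg_iff_add_eq_0)
  moreover have "open \<dots>"
    by (intro continuous_open_preimage open_nonzero continuous_intros hc)
  \<comment> \<open>With v = 1/w the graph equation is multiplied by w; at w = 0 it becomes height =
    1, the condition chosen for infinity.\<close>
  moreover have "chartinf_set graph_complement =
      ?Z \<inter> (\<lambda>x. snd (snd x) + 1 + height (fst x, fst (snd x)) * (snd (snd x) - 1)) -` (- {0})"
    by (auto simp: chartinf_set_def graph_complement_def inv_chart_def field_simps)
  moreover have "open \<dots>"
    by (intro continuous_open_preimage open_nonzero continuous_intros hc)
  ultimately have "openin Btilde_top graph_complement"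
    unfolding openin_Btilde_top by (auto simp: graph_complement_def Btilde_def)
  then show ?thesis by (rule openin_pi_B_image[OF act_1_graph_complement])
qed

text \<open>The coordinate u maps the closed disc without 1 to the closed right half-plane, whereas
  \<open>- height z\<close> is negative, so the removed graph lies over the exterior of the closed
  disc.\<close>

lemma Btilde_subset: "Btilde \<subseteq> outer_set \<union> graph_complement"
proof
  fix x assume "x \<in> Btilde"
  then obtain z v where x: "x = (z, v)" "z \<noteq> (0, 0)" by (auto simp: Btilde_def)
  show "x \<in> outer_set \<union> graph_complement"
  proof (cases v)
    case (Some c)
    have "norm c > 1" if eq: "1 + c = - height z * (1 - c)"
    proof -
      define k where "k = norm z powr log 2 3"
      have k: "k > 0" using x by (simp add: k_def zero_prod_def)
      have "(of_real k - 1) * c = of_real (1 + k)"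
        using eq by (simp add: height_def k_def algebra_simps)
      then have "norm (of_real (k - 1) * c) = norm (of_real (1 + k) :: complex)" by simp
      then have eq': "\<bar>k - 1\<bar> * norm c = 1 + k"
        using k unfolding norm_mult norm_of_real by simp
      \<comment> \<open>With |c| <= 1 the left side of \<open>eq'\<close> would be at most |k - 1|,
        which is less than 1 + k because k > 0.\<close>
      have "\<bar>k - 1\<bar> * norm c \<le> \<bar>k - 1\<bar>" if "norm c \<le> 1"
        using that by (intro mult_left_le) auto
      with eq' k show ?thesis by fastforce
    qed
    then show ?thesis using Some x by (auto simp: outer_set_def graph_complement_def)
  qed (use x in \<open>simp add: outer_set_def\<close>)
qed

text \<open>Every point of B outside the image of \<open>graph_complement\<close> has the image of
  \<open>outer_set\<close> as an open neighbourhood missing \<open>Omega\<close>.\<close>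

lemma closure_Omega_subset: "B_top closure_of Omega \<subseteq> pi_B ` graph_complement"
proof
  fix X assume X: "X \<in> B_top closure_of Omega"
  then have "X \<in> topspace B_top" by (simp add: in_closure_of)
  then have "X \<in> Bset" using openin_B_top openin_topspace by blast
  then obtain x where x: "x \<in> Btilde" "X = pi_B x" by (auto simp: Bset_def)
  have "X \<notin> pi_B ` outer_set"
  proof
    assume "X \<in> pi_B ` outer_set"
    then obtain Y where Y: "Y \<in> Omega" "Y \<in> pi_B ` outer_set"
      using X openin_outer by (auto simp: in_closure_of)
    then obtain z c where zc: "Y = pi_B (z, Some c)" "norm c < 1" by (auto simp: Omega_def)
    have "(z, Some c) \<in> \<Union>(pi_B ` outer_set)" using Y zc mem_pi_B_self by blast
    then have "(z, Some c) \<in> outer_set" by (simp add: Union_pi_B_image act_1_outer_set)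
    then show False using zc by (simp add: outer_set_def)
  qed
  then show "X \<in> pi_B ` graph_complement" using x Btilde_subset by blast
qed

theorem theorem3p2:
  shows "\<not> (\<exists>F. (\<forall>V\<in>F. pseudoconvex_open_B V \<and> B_top closure_of Omega \<subseteq> V) \<and>
              (\<forall>W. openin B_top W \<and> B_top closure_of Omega \<subseteq> W \<longrightarrow> (\<exists>V\<in>F. V \<subseteq> W)))
       \<and> \<not> (\<exists>Om :: nat \<Rightarrow> bt set set. (\<forall>n. pseudoconvex_domain_B (Om n)) \<and>
              (\<forall>n. Om (Suc n) \<subseteq> Om n) \<and> (\<Inter>n. Om n) = B_top closure_of Omega)"
proof -
  \<comment> \<open>A point of the removed graph: \<open>(1, 0)\<close> has height 1 and infinity
    has coordinate u = -1.\<close>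
  let ?x = "((1, 0), None) :: bt"
  have x: "pi_B ?x \<notin> pi_B ` graph_complement"
  proof
    assume "pi_B ?x \<in> pi_B ` graph_complement"
    then have "?x \<in> \<Union>(pi_B ` graph_complement)" using mem_pi_B_self by blast
    then have "?x \<in> graph_complement" by (simp add: Union_pi_B_image act_1_graph_complement)
    then show False by (simp add: graph_complement_def height_def norm_Pair)
  qed
  have full: "pi_B ?x \<in> V" if "pseudoconvex_open_B V" "B_top closure_of Omega \<subseteq> V" for V
  proof -
    have "V \<subseteq> Bset" using that by (simp add: pseudoconvex_open_B_def openin_B_top)
    moreover have "?x \<in> \<Union>V" using Union_pseudoconvex_eq_Btilde[OF that] by (simp add: Btilde_def)
    ultimately show ?thesis by (simp only: Union_Bset_iff)
  qed
  show ?thesis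
  proof (intro conjI notI)
    assume "\<exists>F. (\<forall>V\<in>F. pseudoconvex_open_B V \<and> B_top closure_of Omega \<subseteq> V) \<and>
              (\<forall>W. openin B_top W \<and> B_top closure_of Omega \<subseteq> W \<longrightarrow> (\<exists>V\<in>F. V \<subseteq> W))"
    then obtain F where F: "\<forall>V\<in>F. pseudoconvex_open_B V \<and> B_top closure_of Omega \<subseteq> V"
      "\<forall>W. openin B_top W \<and> B_top closure_of Omega \<subseteq> W \<longrightarrow> (\<exists>V\<in>F. V \<subseteq> W)"
      by (elim exE conjE) (rule that)
    have "\<exists>V\<in>F. V \<subseteq> pi_B ` graph_complement"
      using F(2) openin_graph_complement closure_Omega_subset by simp
    then obtain V where V: "V \<in> F" "V \<subseteq> pi_B ` graph_complement" by (rule bexE)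
    have "pi_B ?x \<in> V" using bspec[OF F(1) V(1)] by (elim conjE) (rule full)
    with V(2) x show False by (metis subsetD)
  next
    assume "\<exists>Om :: nat \<Rightarrow> bt set set. (\<forall>n. pseudoconvex_domain_B (Om n)) \<and>
              (\<forall>n. Om (Suc n) \<subseteq> Om n) \<and> (\<Inter>n. Om n) = B_top closure_of Omega"
    then obtain Om :: "nat \<Rightarrow> bt set set" where Om: "\<forall>n. pseudoconvex_domain_B (Om n)"
      "(\<Inter>n. Om n) = B_top closure_of Omega"
      by (elim exE conjE) (rule that)
    have "pi_B ?x \<in> Om n" for n
    proof (rule full)
      show "pseudoconvex_open_B (Om n)" using Om(1) by (simp add: pseudoconvex_domain_B_def)
      show "B_top closure_of Omega \<subseteq> Om n" unfolding Om(2)[symmetric] by (rule INF_lower) simp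
    qed
    then have "pi_B ?x \<in> B_top closure_of Omega" unfolding Om(2)[symmetric] by (rule INT_I)
    with closure_Omega_subset have "pi_B ?x \<in> pi_B ` graph_complement" by (rule subsetD)
    with x show False by (rule notE)
  qed
qed

end
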